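(* Let $A$, $B$ be irreducible square matrices with entries in $\{0,1\}$. The two-sided topological Markov shifts $(\bar X_A,\bar\sigma_A)$ and $(\bar X_B,\bar\sigma_B)$ are asymptotically conjugate if and only if they are topologically conjugate.
   Context: For an $N\times N$ $\{0,1\}$-matrix $A$: $\bar X_A=\{(x_i)_{i\in\mathbb Z}\in\{1,\dots,N\}^{\mathbb Z}: A(x_i,x_{i+1})=1\ \forall i\}$ with the product topology and $\bar\sigma_A((x_i)_i)=(x_{i+1})_i$. For $x\in\bar X_A$ put $x_+=(x_n)_{n\ge0}$, $x_-=(x_{-n})_{n\ge0}$; $\bar\sigma^k(y)_\pm$ means $(\bar\sigma^k(y))_\pm$. $\mathbb Z_+=\{0,1,2,\dots\}$. Topological conjugacy: a homeomorphism $h:\bar X_A\to\bar X_B$ with $h\circ\bar\sigma_A=\bar\sigma_B\circ h$. $G_A^a=\bigcup_n\{(x,z)\in\bar X_A\times\bar X_A: x_i=z_i\text{ for all }|i|\ge n\}$, with the inductive limit topology of these subsets (each with the relative product topology). $(\bar X_A,\bar\sigma_A)$ and $(\bar X_B,\bar\sigma_B)$ are **asymptotically conjugate** if there is a homeomorphism $h:\bar X_A\to\bar X_B$ such that: (1) there is $K\in\mathbb Z_+$ with $\bar\sigma_B^{K+1}(h(x))_+=\bar\sigma_B^{K}(h(\bar\sigma_A(x)))_+$ and $\bar\sigma_B^{-K+1}(h(x))_-=\bar\sigma_B^{-K}(h(\bar\sigma_A(x)))_-$ for all $x\in\bar X_A$, and $\bar\sigma_A^{K+1}(h^{-1}(y))_+=\bar\sigma_A^{K}(h^{-1}(\bar\sigma_B(y)))_+$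 and $\bar\sigma_A^{-K+1}(h^{-1}(y))_-=\bar\sigma_A^{-K}(h^{-1}(\bar\sigma_B(y)))_-$ for all $y\in\bar X_B$; (2) there is a continuous $m_1:G_A^a\to\mathbb Z_+$ with $\bar\sigma_B^{m_1(x,z)}(h(x))_+=\bar\sigma_B^{m_1(x,z)}(h(z))_+$ and $\bar\sigma_B^{-m_1(x,z)}(h(x))_-=\bar\sigma_B^{-m_1(x,z)}(h(z))_-$ for all $(x,z)\in G_A^a$; (3) there is a continuous $m_2:G_B^a\to\mathbb Z_+$ with $\bar\sigma_A^{m_2(y,w)}(h^{-1}(y))_+=\bar\sigma_A^{m_2(y,w)}(h^{-1}(w))_+$ and $\bar\sigma_A^{-m_2(y,w)}(h^{-1}(y))_-=\bar\sigma_A^{-m_2(y,w)}(h^{-1}(w))_-$ for all $(y,w)\in G_B^a$. *)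

theory Defs
  imports "HOL-Analysis.Analysis"
begin

definition zero_one_matrix :: "nat ^ 'n ^ 'n \<Rightarrow> bool" where
  "zero_one_matrix A \<longleftrightarrow> (\<forall>i j. A $ i $ j \<in> {0, 1})"

primrec matrix_power :: "nat ^ 'n ^ 'n \<Rightarrow> nat \<Rightarrow> nat ^ 'n ^ 'n" where
  "matrix_power A 0 = mat 1"
| "matrix_power A (Suc k) = A ** matrix_power A k"

text \<open>
  Exponent \<open>0\<close> is allowed, as in Lind and Marcus. Compared with requiring a positive exponent,
  this only adds the one-by-one zero matrix, whose shift space is empty.
\<close>

definition irreducible_matrix :: "nat ^ 'n ^ 'n \<Rightarrow> bool" where
  "irreducible_matrix A \<longleftrightarrow> (\<forall>i j. \<exists>k. matrix_power A k $ i $ j > 0)"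

text \<open>The alphabet \<open>{1, \<dots>, N}\<close> is the index type of the matrix.\<close>

definition markov_space :: "nat ^ 'n ^ 'n \<Rightarrow> (int \<Rightarrow> 'n) set" where
  "markov_space A = {x. \<forall>i. A $ x i $ x (i + 1) = 1}"

definition markov_top :: "nat ^ 'n ^ 'n \<Rightarrow> (int \<Rightarrow> 'n) topology" where
  "markov_top A =
    subtopology (product_topology (\<lambda>_. discrete_topology UNIV) UNIV) (markov_space A)"

definition shift :: "(int \<Rightarrow> 'a) \<Rightarrow> int \<Rightarrow> 'a" where
  "shift x = (\<lambda>i. x (i + 1))"

text \<open>
  Integer iterates are taken on all bi-infinite sequences, where the shift is a bijection; it maps
  each \<open>markov_space A\<close> onto itself (see \<open>shift_image_markov_space\<close>).
\<close>

definition shift_pow :: "int \<Rightarrow> (int \<Rightarrow> 'a) \<Rightarrow> int \<Rightarrow> 'a" where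
  "shift_pow k = (if 0 \<le> k then shift ^^ nat k else inv shift ^^ nat (- k))"

definition right_part :: "(int \<Rightarrow> 'a) \<Rightarrow> nat \<Rightarrow> 'a" where
  "right_part x = (\<lambda>n. x (int n))"

definition left_part :: "(int \<Rightarrow> 'a) \<Rightarrow> nat \<Rightarrow> 'a" where
  "left_part x = (\<lambda>n. x (- int n))"

lemma bij_shift: "bij shift"
  by (rule o_bij[of "\<lambda>x i. x (i - 1)"]) (auto simp: shift_def fun_eq_iff)

lemma inv_shift: "inv shift = (\<lambda>x i. x (i - 1))"
  by (rule inv_equality) (auto simp: shift_def)

lemma shift_pow_apply: "shift_pow k x = (\<lambda>i. x (i + k))"
proof -
  have "(shift ^^ m) x = (\<lambda>i. x (i + int m))" for m and x :: "int \<Rightarrow> 'a"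
    by (induction m arbitrary: x) (auto simp: shift_def algebra_simps)
  moreover have "(inv shift ^^ m) x = (\<lambda>i. x (i - int m))" for m and x :: "int \<Rightarrow> 'a"
    by (induction m arbitrary: x) (auto simp: inv_shift algebra_simps)
  ultimately show ?thesis
    by (auto simp: shift_pow_def)
qed

lemma topspace_markov_top: "topspace (markov_top A) = markov_space A"
  by (simp add: markov_top_def)

lemma shift_image_markov_space: "shift ` markov_space A = markov_space A"
proof (intro equalityI subsetI)
  fix x assume "x \<in> markov_space A"
  then have "A $ x (i - 1) $ x (i - 1 + 1) = 1" for i
    by (simp only: markov_space_def mem_Collect_eq)
  then have "(\<lambda>i. x (i - 1)) \<in> markov_space A"
    by (simp add: markov_space_def)
  then show "x \<in> shift ` markov_space A"
    by (rule image_eqI[rotated]) (simp add: shift_def)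
qed (auto simp: markov_space_def shift_def)

definition topologically_conjugate ::
  "nat ^ 'n ^ 'n \<Rightarrow> nat ^ 'm ^ 'm \<Rightarrow> bool" where
  "topologically_conjugate A B \<longleftrightarrow>
    (\<exists>h. homeomorphic_map (markov_top A) (markov_top B) h \<and>
         (\<forall>x \<in> markov_space A. h (shift x) = shift (h x)))"

definition asym_level :: "nat ^ 'n ^ 'n \<Rightarrow> nat \<Rightarrow> ((int \<Rightarrow> 'n) \<times> (int \<Rightarrow> 'n)) set" where
  "asym_level A n =
    {(x, z) \<in> markov_space A \<times> markov_space A. \<forall>i. int n \<le> \<bar>i\<bar> \<longrightarrow> x i = z i}"

definition asym_rel :: "nat ^ 'n ^ 'n \<Rightarrow> ((int \<Rightarrow> 'n) \<times> (int \<Rightarrow> 'n)) set" where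
  "asym_rel A = (\<Union>n. asym_level A n)"

definition asym_level_top :: "nat ^ 'n ^ 'n \<Rightarrow> nat \<Rightarrow> ((int \<Rightarrow> 'n) \<times> (int \<Rightarrow> 'n)) topology" where
  "asym_level_top A n = subtopology (prod_topology (markov_top A) (markov_top A)) (asym_level A n)"

text \<open>The inductive limit topology: the finest one making all level inclusions continuous.\<close>

definition asym_top :: "nat ^ 'n ^ 'n \<Rightarrow> ((int \<Rightarrow> 'n) \<times> (int \<Rightarrow> 'n)) topology" where
  "asym_top A = topology (\<lambda>U. U \<subseteq> asym_rel A \<and>
     (\<forall>n. openin (asym_level_top A n) (U \<inter> asym_level A n)))"

lemma openin_asym_top:
  "openin (asym_top A) U \<longleftrightarrow>
    U \<subseteq> asym_rel A \<and> (\<forall>n. openin (asym_level_top A n) (U \<inter> asym_level A n))"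
proof -
  have "istopology (\<lambda>U. U \<subseteq> asym_rel A \<and>
     (\<forall>n. openin (asym_level_top A n) (U \<inter> asym_level A n)))"
    unfolding istopology_def
  proof (intro conjI allI impI)
    fix S T
    assume S: "S \<subseteq> asym_rel A \<and> (\<forall>n. openin (asym_level_top A n) (S \<inter> asym_level A n))"
      and T: "T \<subseteq> asym_rel A \<and> (\<forall>n. openin (asym_level_top A n) (T \<inter> asym_level A n))"
    show "S \<inter> T \<subseteq> asym_rel A"
      using S by blast
    fix n
    have "openin (asym_level_top A n) ((S \<inter> asym_level A n) \<inter> (T \<inter> asym_level A n))"
      by (rule openin_Int) (simp_all only: S T)
    moreover have "(S \<inter> asym_level A n) \<inter> (T \<inter> asym_level A n) = S \<inter> T \<inter> asym_level A n"
      by blast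
    ultimately show "openin (asym_level_top A n) (S \<inter> T \<inter> asym_level A n)"
      by simp
  next
    fix \<K>
    assume K: "\<forall>K\<in>\<K>. K \<subseteq> asym_rel A \<and> (\<forall>n. openin (asym_level_top A n) (K \<inter> asym_level A n))"
    show "\<Union>\<K> \<subseteq> asym_rel A"
      using K by blast
    fix n
    have "openin (asym_level_top A n) (\<Union>K\<in>\<K>. K \<inter> asym_level A n)"
      by (rule openin_Union) (use K in auto)
    moreover have "(\<Union>K\<in>\<K>. K \<inter> asym_level A n) = \<Union>\<K> \<inter> asym_level A n"
      by blast
    ultimately show "openin (asym_level_top A n) (\<Union>\<K> \<inter> asym_level A n)"
      by simp
  qed
  then show ?thesis
    unfolding asym_top_def by simp
qed

lemma topspace_asym_level_top: "topspace (asym_level_top A n) = asym_level A n"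
  by (auto simp: asym_level_top_def topspace_markov_top asym_level_def)

lemma topspace_asym_top: "topspace (asym_top A) = asym_rel A"
proof (rule subset_antisym)
  show "topspace (asym_top A) \<subseteq> asym_rel A"
    using openin_asym_top[of A "topspace (asym_top A)"] by simp
  have "asym_rel A \<inter> asym_level A n = topspace (asym_level_top A n)" for n
    by (auto simp: asym_rel_def topspace_asym_level_top)
  then have "openin (asym_top A) (asym_rel A)"
    by (simp add: openin_asym_top)
  then show "asym_rel A \<subseteq> topspace (asym_top A)"
    by (rule openin_subset)
qed

definition almost_intertwines ::
  "nat \<Rightarrow> nat ^ 'n ^ 'n \<Rightarrow> ((int \<Rightarrow> 'n) \<Rightarrow> int \<Rightarrow> 'm) \<Rightarrow> bool" where
  "almost_intertwines K A h \<longleftrightarrow>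
    (\<forall>x \<in> markov_space A.
       right_part (shift_pow (int K + 1) (h x)) = right_part (shift_pow (int K) (h (shift x))) \<and>
       left_part (shift_pow (- int K + 1) (h x)) = left_part (shift_pow (- int K) (h (shift x))))"

definition asym_bound ::
  "nat ^ 'n ^ 'n \<Rightarrow> ((int \<Rightarrow> 'n) \<Rightarrow> int \<Rightarrow> 'm) \<Rightarrow> ((int \<Rightarrow> 'n) \<times> (int \<Rightarrow> 'n) \<Rightarrow> nat) \<Rightarrow> bool" where
  "asym_bound A h m \<longleftrightarrow>
    continuous_map (asym_top A) (discrete_topology UNIV) m \<and>
    (\<forall>(x, z) \<in> asym_rel A.
       right_part (shift_pow (int (m (x, z))) (h x)) =
         right_part (shift_pow (int (m (x, z))) (h z)) \<and>
       left_part (shift_pow (- int (m (x, z))) (h x)) =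
         left_part (shift_pow (- int (m (x, z))) (h z)))"

definition asymptotically_conjugate ::
  "nat ^ 'n ^ 'n \<Rightarrow> nat ^ 'm ^ 'm \<Rightarrow> bool" where
  "asymptotically_conjugate A B \<longleftrightarrow>
    (\<exists>h. homeomorphic_map (markov_top A) (markov_top B) h \<and>
         (\<exists>K. almost_intertwines K A h \<and>
              almost_intertwines K B (inv_into (markov_space A) h)) \<and>
         (\<exists>m\<^sub>1. asym_bound A h m\<^sub>1) \<and>
         (\<exists>m\<^sub>2. asym_bound B (inv_into (markov_space A) h) m\<^sub>2))"

end

theory Submission
  imports Defs
begin

text \<open>
  Let \<open>h\<close> be an asymptotic conjugacy with constant \<open>K\<close>. On coordinates \<open>i \<ge> K\<close> it commutes with
  the shift, so reading \<open>h\<close> at coordinate \<open>K\<close> along the orbit of a point gives a sliding block code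
  \<open>g\<close> that agrees with \<open>h\<close> on \<open>[K, \<infinity>)\<close>. The same construction for the inverse of \<open>h\<close> gives a
  sliding block code \<open>f\<close>. Since \<open>f\<close> only looks at a finite window, \<open>f (g x)\<close> agrees with \<open>x\<close> far to
  the right, uniformly in \<open>x\<close>, and hence everywhere because \<open>f\<close> and \<open>g\<close> commute with the shift.

  Conversely, a conjugacy is a sliding block code, say with window \<open>[-M, M]\<close>. It maps points that
  agree outside \<open>(-n, n)\<close> to points that agree outside \<open>(-n-M, n+M)\<close>, and the least such \<open>n\<close> depends
  continuously on the pair.
\<close>

section \<open>Agreement on central windows, and integer powers of the shift\<close>

text \<open>For fixed \<open>x\<close> and \<open>M\<close> this describes a central cylinder. The
  radius is an integer, so that it can be added to shift amounts; a negative radius imposes no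
  condition.\<close>

definition agree_upto :: "int \<Rightarrow> (int \<Rightarrow> 'a) \<Rightarrow> (int \<Rightarrow> 'a) \<Rightarrow> bool" where
  "agree_upto M x z \<longleftrightarrow> (\<forall>i. \<bar>i\<bar> \<le> M \<longrightarrow> x i = z i)"

lemma agree_upto_refl: "agree_upto M x x"
  by (simp add: agree_upto_def)

lemma agree_upto_trans: "agree_upto M x y \<Longrightarrow> agree_upto M y z \<Longrightarrow> agree_upto M x z"
  by (simp add: agree_upto_def)

lemma agree_upto_mono: "agree_upto M x z \<Longrightarrow> M' \<le> M \<Longrightarrow> agree_upto M' x z"
  by (simp add: agree_upto_def)

lemma agree_upto_shift_pow:
  "agree_upto (M + \<bar>k\<bar>) x z \<Longrightarrow> agree_upto M (shift_pow k x) (shift_pow k z)"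
  by (auto simp: agree_upto_def shift_pow_apply)

lemma shift_pow_shift_pow: "shift_pow a (shift_pow b x) = shift_pow (a + b) x"
  by (simp add: shift_pow_apply algebra_simps)

lemma shift_pow_0: "shift_pow 0 x = x"
  by (simp add: shift_pow_apply)

lemma shift_pow_Suc: "shift_pow (int (Suc n)) x = shift_pow (int n) (shift x)"
  by (simp add: shift_pow_apply shift_def algebra_simps)

lemma shift_pow_in_markov_space:
  assumes "x \<in> markov_space A"
  shows "shift_pow k x \<in> markov_space A"
proof -
  have "A $ x (i + k) $ x (i + k + 1) = 1" for i
    using assms unfolding markov_space_def by blast
  then show ?thesis
    by (simp add: markov_space_def shift_pow_apply add.commute add.left_commute)
qed

lemma shift_in_markov_space: "x \<in> markov_space A \<Longrightarrow> shift x \<in> markov_space A"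
  using shift_image_markov_space by blast

section \<open>The topology of the shift space in terms of central cylinders\<close>

text \<open>A basic open set of the product constrains only finitely many coordinates, so around
  each of its points it contains a central cylinder. Conversely, a central cylinder is itself a
  basic open set.\<close>

lemma openin_markov_top:
  "openin (markov_top A) U \<longleftrightarrow> U \<subseteq> markov_space A \<and>
     (\<forall>x\<in>U. \<exists>M. \<forall>z\<in>markov_space A. agree_upto M x z \<longrightarrow> z \<in> U)"
  (is "?L \<longleftrightarrow> ?R")
proof
  assume ?L
  then obtain T where T: "openin (product_topology (\<lambda>_. discrete_topology UNIV) UNIV) T"
    and U: "U = T \<inter> markov_space A"
    by (auto simp: markov_top_def openin_subtopology)
  have "\<exists>M. \<forall>z\<in>markov_space A. agree_upto M x z \<longrightarrow> z \<in> U" if x: "x \<in> U" for x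
  proof -
    have "x \<in> T"
      using x U by simp
    then obtain W where W: "finite {i. W i \<noteq> UNIV}" "x \<in> Pi\<^sub>E UNIV W" "Pi\<^sub>E UNIV W \<subseteq> T"
      using T by (force simp: openin_product_topology_alt)
    \<comment> \<open>The \<open>0\<close> keeps \<open>Max\<close> meaningful when no coordinate is
      constrained.\<close>
    define M where "M = Max (insert 0 (abs ` {i. W i \<noteq> UNIV}))"
    have M: "\<bar>i\<bar> \<le> M" if "W i \<noteq> UNIV" for i
      unfolding M_def using that W(1) by (intro Max_ge) auto
    have "z \<in> U" if "z \<in> markov_space A" "agree_upto M x z" for z
    proof -
      have "z i \<in> W i" for i
      proof (cases "W i = UNIV")
        case False
        then have "z i = x i"
          using M that(2) by (simp add: agree_upto_def)
        then show ?thesis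
          using W(2) by (auto simp: PiE_def Pi_def)
      qed simp
      then have "z \<in> Pi\<^sub>E UNIV W"
        by auto
      then show ?thesis
        using W(3) U that(1) by auto
    qed
    then show ?thesis
      by blast
  qed
  then show ?R
    using U by blast
next
  assume R: ?R
  show ?L
  proof (subst openin_subopen, intro ballI)
    fix x assume x: "x \<in> U"
    then obtain M where M: "\<And>z. z \<in> markov_space A \<Longrightarrow> agree_upto M x z \<Longrightarrow> z \<in> U"
      using R by blast
    define T where "T = Pi\<^sub>E UNIV (\<lambda>i. if \<bar>i\<bar> \<le> M then {x i} else UNIV)"
    have "finite {i. \<bar>i\<bar> \<le> M}"
      by (rule finite_subset[of _ "{-M..M}"]) auto
    then have "finite {i. (if \<bar>i\<bar> \<le> M then {x i} else UNIV) \<noteq> UNIV}"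
      by (rule finite_subset[rotated]) auto
    then have "openin (product_topology (\<lambda>_. discrete_topology UNIV) UNIV) T"
      unfolding T_def by (intro product_topology_basis) auto
    then have "openin (markov_top A) (T \<inter> markov_space A)"
      by (auto simp: markov_top_def openin_subtopology)
    moreover have "x \<in> T \<inter> markov_space A"
      using x R by (auto simp: T_def)
    moreover have "T \<inter> markov_space A \<subseteq> U"
      by (auto intro!: M simp: T_def agree_upto_def PiE_def Pi_def split: if_splits)
    ultimately show "\<exists>T. openin (markov_top A) T \<and> x \<in> T \<and> T \<subseteq> U"
      by blast
  qed
qed

lemma openin_cylinder: "openin (markov_top A) {z \<in> markov_space A. agree_upto M x z}"
  by (auto simp: openin_markov_top intro: agree_upto_trans)

text \<open>The alphabet is finite, so the full shift is compact by Tychonoff. The Markov shift is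
  closed in it: a point outside has a forbidden transition at some position, an open condition on
  two coordinates.\<close>

lemma compact_space_markov_top:
  fixes A :: "nat ^ 'n ^ 'n"
  shows "compact_space (markov_top A)"
proof -
  let ?P = "product_topology (\<lambda>_::int. discrete_topology (UNIV :: 'n set)) UNIV"
  have coord: "openin ?P {x. x i = a}" for i a
    using openin_continuous_map_preimage[OF continuous_map_product_projection[of i UNIV
          "\<lambda>_. discrete_topology (UNIV :: 'n set)"], of "{a}"]
    by simp
  have "- markov_space A =
      (\<Union>i. \<Union>a. \<Union>b\<in>{b. A $ a $ b \<noteq> 1}. {x. x i = a} \<inter> {x. x (i + 1) = b})"
    by (auto simp: markov_space_def)
  also have "openin ?P \<dots>"
    by (intro openin_Union openin_Int coord ballI) (auto intro!: openin_Union openin_Int coord)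
  finally have "closedin ?P (markov_space A)"
    by (simp add: closedin_def Compl_eq_Diff_UNIV)
  moreover have "compact_space ?P"
    by (simp add: compact_space_product_topology compact_space_discrete_topology)
  ultimately show ?thesis
    unfolding markov_top_def
    by (intro compact_space_subtopology closedin_compact_space)
qed

text \<open>Each coordinate of a continuous map is locally constant, and compactness makes the
  radius uniform. Together with commutation with the shift, this is what turns a map into a sliding
  block code.\<close>

lemma continuous_map_markov_top:
  "continuous_map (markov_top A) (markov_top B) h \<longleftrightarrow>
     h \<in> markov_space A \<rightarrow> markov_space B \<and>
     (\<forall>j. \<exists>M. \<forall>x\<in>markov_space A. \<forall>z\<in>markov_space A. agree_upto M x z \<longrightarrow> h x j = h z j)"
  (is "?L \<longleftrightarrow> ?R")
proof
  assume L: ?L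
  have "\<exists>M. \<forall>x\<in>markov_space A. \<forall>z\<in>markov_space A. agree_upto M x z \<longrightarrow> h x j = h z j" for j
  proof -
    have op: "openin (markov_top A) {z \<in> markov_space A. h z j = a}" for a
    proof -
      have "openin (markov_top B) {y \<in> markov_space B. y j = a}"
        by (auto simp: openin_markov_top agree_upto_def intro!: exI[of _ "\<bar>j\<bar>"])
      then have "openin (markov_top A)
          {z \<in> topspace (markov_top A). h z \<in> {y \<in> markov_space B. y j = a}}"
        by (rule openin_continuous_map_preimage[OF L])
      moreover have "{z \<in> topspace (markov_top A). h z \<in> {y \<in> markov_space B. y j = a}} =
          {z \<in> markov_space A. h z j = a}"
        using continuous_map_funspace[OF L] by (auto simp: topspace_markov_top)
      ultimately show ?thesis
        by simp
    qed
    have "\<exists>M. \<forall>z\<in>markov_space A. agree_upto M x z \<longrightarrow> h z j = h x j" if "x \<in> markov_space A" for x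
      using op[of "h x j"] that by (auto simp: openin_markov_top)
    then obtain M where M:
      "\<And>x z. x \<in> markov_space A \<Longrightarrow> z \<in> markov_space A \<Longrightarrow> agree_upto (M x) x z \<Longrightarrow> h z j = h x j"
      by metis
    define C where "C x = {z \<in> markov_space A. agree_upto (M x) x z}" for x
    have "(\<forall>U\<in>C ` markov_space A. openin (markov_top A) U) \<and>
        topspace (markov_top A) \<subseteq> \<Union>(C ` markov_space A)"
      by (auto simp: C_def openin_cylinder topspace_markov_top agree_upto_refl)
    then have "\<exists>\<F>. finite \<F> \<and> \<F> \<subseteq> C ` markov_space A \<and> topspace (markov_top A) \<subseteq> \<Union>\<F>"
      by (rule mp[OF spec[OF compact_space_markov_top[of A, unfolded compact_space_alt]]])
    then obtain \<F> where \<F>: "finite \<F>" "\<F> \<subseteq> C ` markov_space A" "markov_space A \<subseteq> \<Union>\<F>"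
      unfolding topspace_markov_top by blast
    obtain F where F: "F \<subseteq> markov_space A" "finite F" "\<F> = C ` F"
      using finite_subset_image[OF \<F>(1,2)] by blast
    define N where "N = Max (insert 0 (M ` F))"
    have N: "M x \<le> N" if "x \<in> F" for x
      unfolding N_def using that F(2) by (intro Max_ge) auto
    have "h x j = h z j"
      if xz: "x \<in> markov_space A" "z \<in> markov_space A" "agree_upto N x z" for x z
    \<comment> \<open>Both \<open>x\<close> and \<open>z\<close> lie in the cylinder around one
      centre \<open>w\<close>, so both values equal \<open>h w j\<close>.\<close>
    proof -
      obtain w where w: "w \<in> F" "x \<in> C w"
        using F(3) \<F>(3) xz(1) by blast
      then have "agree_upto (M w) w x" "w \<in> markov_space A"
        using F(1) by (auto simp: C_def)
      moreover have "agree_upto (M w) w z"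
        using calculation(1) xz(3) N[OF w(1)] by (meson agree_upto_mono agree_upto_trans)
      ultimately show ?thesis
        using M xz by metis
    qed
    then show ?thesis
      by blast
  qed
  then show ?R
    using continuous_map_funspace[OF L] by (simp add: topspace_markov_top)
next
  assume R: ?R
  have "continuous_map (markov_top A) (discrete_topology UNIV) (\<lambda>x. h x j)" for j
  proof -
    obtain M where M: "\<And>x z. x \<in> markov_space A \<Longrightarrow> z \<in> markov_space A \<Longrightarrow>
        agree_upto M x z \<Longrightarrow> h x j = h z j"
      using R by blast
    have "openin (markov_top A) {x \<in> markov_space A. h x j \<in> U}" for U
      unfolding openin_markov_top using M by (fastforce intro!: exI[of _ M])
    then show ?thesis
      by (simp add: continuous_map_def topspace_markov_top)
  qed
  then show ?L
    using R unfolding markov_top_def[of B]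
    by (auto simp: continuous_map_in_subtopology continuous_map_componentwise_UNIV topspace_markov_top)
qed

section \<open>Maps that commute with the shift\<close>

lemma equivariant_shift_pow:
  assumes "\<And>x. x \<in> markov_space A \<Longrightarrow> h (shift x) = shift (h x)" "x \<in> markov_space A"
  shows "h (shift_pow k x) = shift_pow k (h x)"
proof -
  have nat: "h (shift_pow (int n) x) = shift_pow (int n) (h x)" if "x \<in> markov_space A" for n x
    using that
  proof (induction n arbitrary: x)
    case (Suc n)
    then show ?case
      by (simp only: shift_pow_Suc assms(1) shift_in_markov_space)
  qed (simp add: shift_pow_0)
  show ?thesis
  proof (cases "k \<ge> 0")
    case True
    then show ?thesis
      using nat[OF assms(2), of "nat k"] by simp
  next
    case False
    \<comment> \<open>For negative \<open>k\<close>, the forward case is applied at the point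
      \<open>shift_pow k x\<close>.\<close>
    then have "h x = shift_pow (- k) (h (shift_pow k x))"
      using nat[OF shift_pow_in_markov_space[OF assms(2)], of "nat (- k)" k]
      by (simp add: shift_pow_shift_pow shift_pow_0)
    then show ?thesis
      by (simp add: shift_pow_shift_pow shift_pow_0)
  qed
qed

lemma equivariant_almost_intertwines:
  assumes "\<And>x. x \<in> markov_space A \<Longrightarrow> h (shift x) = shift (h x)"
  shows "almost_intertwines 0 A h"
  unfolding almost_intertwines_def
  by (intro ballI, subst (1 2) assms) (simp_all add: shift_pow_apply shift_def)

text \<open>Openness in the inductive limit is tested level by level. On level \<open>n\<close> the
  hypothesis makes \<open>m\<close> constant on the trace of a product of two cylinders of radius
  \<open>n\<close>, which is open in that level.\<close>

lemma continuous_map_asym_top: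
  fixes m :: "(int \<Rightarrow> 'n::finite) \<times> (int \<Rightarrow> 'n) \<Rightarrow> 'b"
  assumes "\<And>n x z x' z'. (x, z) \<in> asym_level A n \<Longrightarrow> (x', z') \<in> asym_level A n \<Longrightarrow>
    agree_upto (int n) x x' \<Longrightarrow> agree_upto (int n) z z' \<Longrightarrow> m (x, z) = m (x', z')"
  shows "continuous_map (asym_top A) (discrete_topology UNIV) m"
proof -
  have "openin (asym_top A) {p \<in> asym_rel A. m p \<in> U}" for U
    unfolding openin_asym_top
  proof (intro conjI allI)
    fix n
    show "openin (asym_level_top A n) ({p \<in> asym_rel A. m p \<in> U} \<inter> asym_level A n)"
    proof (subst openin_subopen, intro ballI)
      fix p assume p: "p \<in> {p \<in> asym_rel A. m p \<in> U} \<inter> asym_level A n"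
      obtain x z where xz: "p = (x, z)"
        by (cases p)
      define T where "T = ({x' \<in> markov_space A. agree_upto (int n) x x'} \<times>
        {z' \<in> markov_space A. agree_upto (int n) z z'}) \<inter> asym_level A n"
      have "openin (asym_level_top A n) T"
        unfolding T_def asym_level_top_def
        by (intro openin_subtopology_Int) (simp add: openin_prod_Times_iff openin_cylinder)
      moreover have "p \<in> T"
        using p by (auto simp: xz T_def asym_level_def agree_upto_refl)
      moreover have "T \<subseteq> {p \<in> asym_rel A. m p \<in> U} \<inter> asym_level A n"
      proof
        fix q assume q: "q \<in> T"
        then have "m q = m p"
          using p assms[of x z n "fst q" "snd q"] by (auto simp: xz T_def)
        then show "q \<in> {p \<in> asym_rel A. m p \<in> U} \<inter> asym_level A n"
          using p q by (auto simp: T_def asym_rel_def)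
      qed
      ultimately show "\<exists>T. openin (asym_level_top A n) T \<and> p \<in> T \<and>
          T \<subseteq> {p \<in> asym_rel A. m p \<in> U} \<inter> asym_level A n"
        by blast
    qed
  qed auto
  then show ?thesis
    by (simp add: continuous_map_def topspace_asym_top)
qed

lemma equivariant_asym_bound:
  assumes cont: "continuous_map (markov_top A) (markov_top B) h"
    and equi: "\<And>x. x \<in> markov_space A \<Longrightarrow> h (shift x) = shift (h x)"
  shows "\<exists>m. asym_bound A h m"
proof -
  obtain M0 where M0: "\<And>x z. x \<in> markov_space A \<Longrightarrow> z \<in> markov_space A \<Longrightarrow>
      agree_upto M0 x z \<Longrightarrow> h x 0 = h z 0"
    using cont unfolding continuous_map_markov_top by blast
  \<comment> \<open>The radius \<open>M0\<close> may be negative, while \<open>M\<close> has to be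
    added to a natural number below.\<close>
  define M where "M = nat M0"
  have M: "h x i = h z i" if "x \<in> markov_space A" "z \<in> markov_space A"
    "\<And>k. \<bar>k\<bar> \<le> int M \<Longrightarrow> x (k + i) = z (k + i)" for x z i
  proof -
    have "agree_upto M0 (shift_pow i x) (shift_pow i z)"
      unfolding agree_upto_def shift_pow_apply
    proof (intro allI impI)
      fix k assume "\<bar>k\<bar> \<le> M0"
      then have "\<bar>k\<bar> \<le> int M"
        unfolding M_def by arith
      then show "x (k + i) = z (k + i)"
        by (rule that(3))
    qed
    then have "h (shift_pow i x) 0 = h (shift_pow i z) 0"
      by (intro M0 shift_pow_in_markov_space that)
    then show ?thesis
      using that by (simp add: equivariant_shift_pow[of A h, OF equi]) (simp add: shift_pow_apply)
  qed
  define l where "l p = (LEAST n. p \<in> asym_level A n)" for p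
  have l: "p \<in> asym_level A (l p)" if "p \<in> asym_rel A" for p
    unfolding l_def using that by (auto simp: asym_rel_def intro: LeastI)
  have l_cong: "l (x, z) = l (x', z')"
    if "(x, z) \<in> asym_level A n" "(x', z') \<in> asym_level A n"
      "agree_upto (int n) x x'" "agree_upto (int n) z z'" for n x z x' z'
  proof -
    \<comment> \<open>Inside the window the two pairs have the same entries; outside it both
      equations hold, since both pairs lie in level \<open>n\<close>.\<close>
    have "x i = z i \<longleftrightarrow> x' i = z' i" for i
      using that by (cases "\<bar>i\<bar> \<le> int n") (auto simp: agree_upto_def asym_level_def)
    then have "(x, z) \<in> asym_level A k \<longleftrightarrow> (x', z') \<in> asym_level A k" for k
      using that(1,2) by (auto simp: asym_level_def)
    then show ?thesis
      by (simp add: l_def)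
  qed
  have bound: "h x i = h z i" if "(x, z) \<in> asym_rel A" "\<bar>i\<bar> \<ge> int (l (x, z) + M)" for x z i
    \<comment> \<open>From \<bar>i\<bar> \<ge> l + M the whole window of radius \<open>M\<close>
      around \<open>i\<close> stays at distance at least \<open>l\<close> from 0, where
      \<open>x\<close> and \<open>z\<close> coincide.\<close>
    using l[OF that(1)] that(2) by (intro M) (auto simp: asym_level_def)
  have "asym_bound A h (\<lambda>p. l p + M)"
    unfolding asym_bound_def
  proof (intro conjI ballI)
    show "continuous_map (asym_top A) (discrete_topology UNIV) (\<lambda>p. l p + M)"
      by (intro continuous_map_asym_top arg_cong[where f = "\<lambda>k. k + M"] l_cong)
  qed (auto simp: right_part_def left_part_def shift_pow_apply fun_eq_iff intro!: bound)
  then show ?thesis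
    by blast
qed

section \<open>The sliding block code read off from the right tail\<close>

text \<open>The shift by \<open>j - K\<close> moves coordinate \<open>j\<close> to the reading
  position \<open>K\<close>. In this form the code commutes with the shift for every
  \<open>h\<close>.\<close>

definition right_code :: "int \<Rightarrow> ((int \<Rightarrow> 'a) \<Rightarrow> int \<Rightarrow> 'b) \<Rightarrow> (int \<Rightarrow> 'a) \<Rightarrow> int \<Rightarrow> 'b" where
  "right_code K h x = (\<lambda>j. h (shift_pow (j - K) x) K)"

lemma right_code_shift_pow: "right_code K h (shift_pow n x) = shift_pow n (right_code K h x)"
  by (simp add: right_code_def shift_pow_apply algebra_simps)

lemma right_code_shift: "right_code K h (shift x) = shift (right_code K h x)"
  using right_code_shift_pow[of K h 1 x] by (simp add: shift_pow_apply shift_def)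

text \<open>From \<open>K\<close> on, moving the reading position one step to the right compensates
  one shift of the argument, so every \<open>i\<close> \<ge> \<open>K\<close> is as good a reading
  position as \<open>K\<close>. The choice \<open>j = i\<close> shows that the code agrees with
  \<open>h\<close> on [K, \<infinity>).\<close>

lemma right_code_eq:
  assumes "almost_intertwines K A h" "x \<in> markov_space A" "i \<ge> int K"
  shows "right_code (int K) h x j = h (shift_pow (j - i) x) i"
proof -
  have step: "h (shift x) i = h x (i + 1)" if "x \<in> markov_space A" "i \<ge> int K" for x i
  proof -
    have "right_part (shift_pow (int K + 1) (h x)) (nat (i - int K)) =
        right_part (shift_pow (int K) (h (shift x))) (nat (i - int K))"
      using assms(1) that(1) by (simp add: almost_intertwines_def)
    then show ?thesis
      using that(2) by (simp add: right_part_def shift_pow_apply add.commute)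
  qed
  have steps: "h (shift_pow (int n) x) (int K) = h x (int K + int n)"
    if "x \<in> markov_space A" for x n
    using that
  proof (induction n arbitrary: x)
    case (Suc n)
    then have "h (shift_pow (int (Suc n)) x) (int K) = h (shift x) (int K + int n)"
      by (simp only: shift_pow_Suc shift_in_markov_space)
    also have "\<dots> = h x (int K + int n + 1)"
      using Suc.prems by (rule step) simp
    finally show ?case
      by (simp add: algebra_simps)
  qed (simp add: shift_pow_0)
  have "shift_pow (j - int K) x = shift_pow (int (nat (i - int K))) (shift_pow (j - i) x)"
    using assms(3) by (simp add: shift_pow_shift_pow)
  then show ?thesis
    using steps[OF shift_pow_in_markov_space[OF assms(2)], of "nat (i - int K)" "j - i"] assms(3)
    by (simp add: right_code_def)
qed

text \<open>Two consecutive symbols of the code occur as consecutive symbols of a single image point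
  of \<open>h\<close>, read at \<open>K\<close> and \<open>K + 1\<close>, so the transition is
  allowed. Continuity comes from coordinate \<open>K\<close> of \<open>h\<close>, with the window
  widened by the shift amount.\<close>

lemma continuous_map_right_code:
  assumes "continuous_map (markov_top A) (markov_top B) h" "almost_intertwines K A h"
  shows "continuous_map (markov_top A) (markov_top B) (right_code (int K) h)"
  unfolding continuous_map_markov_top
proof (intro conjI allI funcsetI)
  fix x assume x: "x \<in> markov_space A"
  show "right_code (int K) h x \<in> markov_space B"
    unfolding markov_space_def
  proof (intro CollectI allI)
    fix j
    let ?y = "shift_pow (j - int K) x"
    have "h ?y \<in> markov_space B"
      using assms(1) shift_pow_in_markov_space[OF x] by (auto simp: continuous_map_markov_top)
    then have "B $ h ?y (int K) $ h ?y (int K + 1) = 1"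
      by (simp add: markov_space_def)
    moreover have "right_code (int K) h x (j + 1) = h ?y (int K + 1)"
      using right_code_eq[OF assms(2) x, of "int K + 1" "j + 1"] by simp
    ultimately show "B $ right_code (int K) h x j $ right_code (int K) h x (j + 1) = 1"
      by (simp add: right_code_def)
  qed
next
  fix j
  obtain M where M: "\<And>x z. x \<in> markov_space A \<Longrightarrow> z \<in> markov_space A \<Longrightarrow>
      agree_upto M x z \<Longrightarrow> h x (int K) = h z (int K)"
    using assms(1) unfolding continuous_map_markov_top by blast
  show "\<exists>M. \<forall>x\<in>markov_space A. \<forall>z\<in>markov_space A. agree_upto M x z \<longrightarrow>
      right_code (int K) h x j = right_code (int K) h z j"
    unfolding right_code_def
    by (intro exI[of _ "M + \<bar>j - int K\<bar>"] ballI impI M shift_pow_in_markov_space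
        agree_upto_shift_pow)
qed

lemma right_code_inverse:
  assumes h: "continuous_map (markov_top A) (markov_top B) h" "almost_intertwines K A h"
    and k: "continuous_map (markov_top B) (markov_top A) k" "almost_intertwines K B k"
    and kh: "\<And>x. x \<in> markov_space A \<Longrightarrow> k (h x) = x"
    and x: "x \<in> markov_space A"
  shows "right_code (int K) k (right_code (int K) h x) = x"
proof
  fix j
  let ?f = "right_code (int K) k" and ?g = "right_code (int K) h"
  have map: "h x \<in> markov_space B" "?g x \<in> markov_space B" if "x \<in> markov_space A" for x
    using h(1) continuous_map_right_code[OF h] that by (auto simp: continuous_map_markov_top)
  obtain M where M: "\<And>y w. y \<in> markov_space B \<Longrightarrow> w \<in> markov_space B \<Longrightarrow>
      agree_upto M y w \<Longrightarrow> ?f y 0 = ?f w 0"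
    using continuous_map_right_code[OF k] unfolding continuous_map_markov_top by blast
  \<comment> \<open>The window of radius \<open>M\<close> around \<open>i\<close> lies in [K,
    \<infinity>), where \<open>?g w\<close> and \<open>h w\<close> agree; also \<open>i\<close>
    \<ge> \<open>K\<close>, so \<open>?f\<close> may be replaced by \<open>k\<close> at
    \<open>i\<close>.\<close>
  define i where "i = int K + \<bar>M\<bar>"
  \<comment> \<open>Chosen so that \<open>w i = x j\<close>: the claim at an arbitrary
    \<open>j\<close> becomes one at the fixed coordinate \<open>i\<close>.\<close>
  define w where "w = shift_pow (j - i) x"
  have w: "w \<in> markov_space A"
    using x by (simp add: w_def shift_pow_in_markov_space)
  have "?g w l = h w l" if "l \<ge> int K" for l
    using right_code_eq[OF h(2) w that, of l] by (simp add: shift_pow_0)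
  then have "agree_upto M (shift_pow i (?g w)) (shift_pow i (h w))"
    by (auto simp: agree_upto_def shift_pow_apply i_def)
  then have "?f (shift_pow i (?g w)) 0 = ?f (shift_pow i (h w)) 0"
    by (intro M shift_pow_in_markov_space map w)
  then have "?f (?g w) i = ?f (h w) i"
    by (simp add: right_code_shift_pow) (simp add: shift_pow_apply)
  also have "\<dots> = k (h w) i"
    using right_code_eq[OF k(2) map(1)[OF w], of i i] by (simp add: i_def shift_pow_0)
  also have "\<dots> = w i"
    by (simp add: kh w)
  finally show "?f (?g x) j = x j"
    by (simp add: w_def right_code_shift_pow) (simp add: shift_pow_apply)
qed

section \<open>Equivalence of asymptotic and topological conjugacy\<close>

theorem theorem3p3:
  fixes A :: "nat ^ 'n ^ 'n" and B :: "nat ^ 'm ^ 'm"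
  assumes "zero_one_matrix A" and "irreducible_matrix A"
    and "zero_one_matrix B" and "irreducible_matrix B"
  shows "asymptotically_conjugate A B \<longleftrightarrow> topologically_conjugate A B"
proof
  have inverse: "continuous_map (markov_top A) (markov_top B) h \<and>
      continuous_map (markov_top B) (markov_top A) (inv_into (markov_space A) h) \<and>
      (\<forall>x\<in>markov_space A. inv_into (markov_space A) h (h x) = x) \<and>
      (\<forall>y\<in>markov_space B. h (inv_into (markov_space A) h y) = y)"
    if "homeomorphic_map (markov_top A) (markov_top B) h" for h
  proof -
    have inj: "inj_on h (markov_space A)" and im: "h ` markov_space A = markov_space B"
      using homeomorphic_imp_injective_map[OF that] homeomorphic_imp_surjective_map[OF that]
      by (simp_all add: topspace_markov_top)
    have "\<exists>g. homeomorphic_maps (markov_top A) (markov_top B) h g"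
      using that by (simp add: homeomorphic_map_maps)
    then obtain g where g: "homeomorphic_maps (markov_top A) (markov_top B) h g"
      by blast
    \<comment> \<open>The continuous inverse \<open>g\<close> is an arbitrary witness; it coincides
      with \<open>inv_into\<close> on the shift space of \<open>B\<close>, which transfers
      continuity.\<close>
    have "g y = inv_into (markov_space A) h y" if "y \<in> topspace (markov_top B)" for y
      using g that im inj unfolding homeomorphic_maps_def topspace_markov_top
      by (metis imageE inv_into_f_f)
    then have "continuous_map (markov_top B) (markov_top A) (inv_into (markov_space A) h)"
      using g continuous_map_eq unfolding homeomorphic_maps_def by blast
    then show ?thesis
      using inj im homeomorphic_imp_continuous_map[OF that]
      by (auto simp: f_inv_into_f)
  qed
  {
    assume "asymptotically_conjugate A B"
    then obtain h K where h: "homeomorphic_map (markov_top A) (markov_top B) h"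
      and K: "almost_intertwines K A h" "almost_intertwines K B (inv_into (markov_space A) h)"
      unfolding asymptotically_conjugate_def by blast
    let ?k = "inv_into (markov_space A) h"
    note inv = inverse[OF h]
    have "homeomorphic_maps (markov_top A) (markov_top B)
        (right_code (int K) h) (right_code (int K) ?k)"
      unfolding homeomorphic_maps_def topspace_markov_top
      using inv K
      \<comment> \<open>\<open>right_code_inverse\<close> serves twice, the second time with
        \<open>h\<close> and \<open>?k\<close> exchanged.\<close>
      by (auto intro!: continuous_map_right_code intro: right_code_inverse)
    then show "topologically_conjugate A B"
      unfolding topologically_conjugate_def homeomorphic_map_maps
      by (blast intro: right_code_shift)
  next
    assume "topologically_conjugate A B"
    then obtain h where h: "homeomorphic_map (markov_top A) (markov_top B) h"
      and equi: "\<And>x. x \<in> markov_space A \<Longrightarrow> h (shift x) = shift (h x)"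
      unfolding topologically_conjugate_def by blast
    let ?k = "inv_into (markov_space A) h"
    note inv = inverse[OF h]
    have equi': "?k (shift y) = shift (?k y)" if "y \<in> markov_space B" for y
    proof -
      have ky: "?k y \<in> markov_space A"
        using inv that by (auto simp: continuous_map_markov_top)
      have "?k (shift y) = ?k (h (shift (?k y)))"
        using inv that by (simp add: equi[OF ky])
      also have "\<dots> = shift (?k y)"
        using inv shift_in_markov_space[OF ky] by blast
      finally show ?thesis .
    qed
    \<comment> \<open>Exact commutation of \<open>h\<close> and \<open>?k\<close> with the shift
      gives condition (1) with constant 0; the two bounds come from their block windows.\<close>
    show "asymptotically_conjugate A B"
      unfolding asymptotically_conjugate_def
      using h inv equivariant_almost_intertwines[of A h, OF equi]
        equivariant_almost_intertwines[of B ?k, OF equi']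
        equivariant_asym_bound[of A B h, OF _ equi] equivariant_asym_bound[of B A ?k, OF _ equi']
      by blast
  }
qed

end
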